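(* Let $n$ be a product of distinct primes, let $I$ and $\Lambda$ be sets, and let $P=(p_{\lambda i})$ be a $\Lambda\times I$ matrix with entries in $U_n$, the group of units of $\mathbb{Z}_n$. Then the Rees matrix semigroup $T=\mathcal{M}[\mathbb{Z}_n;I,\Lambda;P]$ over the multiplicative semigroup $\mathbb{Z}_n$ is a completely regular semigroup.
   Context: The Rees matrix semigroup $\mathcal{M}[S;I,\Lambda;P]$ over a semigroup $S$, with $P=(p_{\lambda i})$ a $\Lambda\times I$ matrix over $S$, is the set $I\times S\times\Lambda$ with multiplication $(i,g,\lambda)(j,h,\mu)=(i,g\,p_{\lambda j}\,h,\mu)$. A semigroup is completely regular if each of its elements belongs to a subgroup of it (a subset which is a group under the semigroup operation). *)

theory Defs
  imports
    "HOL-Algebra.IntRing"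
    "HOL-Computational_Algebra.Primes"
begin

text \<open>
  HOL-Algebra's structures with one associative operation begin at monoids, so carrier-based
  semigroups are introduced here, as records with no field for an identity.
\<close>

record 'a sgrp = "'a partial_object" +
  op :: "'a \<Rightarrow> 'a \<Rightarrow> 'a"

definition is_sgrp :: "('a, 'b) sgrp_scheme \<Rightarrow> bool" where
  "is_sgrp S \<longleftrightarrow>
     (\<forall>x \<in> carrier S. \<forall>y \<in> carrier S. op S x y \<in> carrier S) \<and>
     (\<forall>x \<in> carrier S. \<forall>y \<in> carrier S. \<forall>z \<in> carrier S.
        op S (op S x y) z = op S x (op S y z))"

definition mult_sgrp :: "('a, 'b) monoid_scheme \<Rightarrow> 'a sgrp" where
  "mult_sgrp R = \<lparr>carrier = carrier R, op = monoid.mult R\<rparr>"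

text \<open>
  A subgroup of a semigroup is a subset that is a group under the restricted operation.
  Its identity \<open>e\<close> is an idempotent of the semigroup that depends on the subgroup, so
  the \<open>subgroup\<close> predicate of HOL-Algebra does not apply.
\<close>

definition subgroup_of_sgrp :: "'a set \<Rightarrow> ('a, 'b) sgrp_scheme \<Rightarrow> bool" where
  "subgroup_of_sgrp H S \<longleftrightarrow>
     H \<subseteq> carrier S \<and> (\<exists>e. group \<lparr>carrier = H, monoid.mult = op S, one = e\<rparr>)"

definition completely_regular :: "('a, 'b) sgrp_scheme \<Rightarrow> bool" where
  "completely_regular S \<longleftrightarrow>
     is_sgrp S \<and> (\<forall>x \<in> carrier S. \<exists>H. subgroup_of_sgrp H S \<and> x \<in> H)"

text \<open>
  The \<open>\<Lambda> \<times> I\<close> sandwich matrix is a function taking the row index first; only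
  its values on \<open>\<Lambda>\<close> and \<open>I\<close> are relevant.
\<close>

definition Rees_matrix_sgrp ::
  "('a, 'b) sgrp_scheme \<Rightarrow> 'i set \<Rightarrow> 'l set \<Rightarrow> ('l \<Rightarrow> 'i \<Rightarrow> 'a) \<Rightarrow> ('i \<times> 'a \<times> 'l) sgrp" where
  "Rees_matrix_sgrp S I \<Lambda> P =
     \<lparr>carrier = I \<times> carrier S \<times> \<Lambda>,
      op = (\<lambda>(i, g, l) (j, h, m). (i, op S (op S g (P l j)) h, m))\<rparr>"

end

theory Submission
  imports Defs "HOL-Computational_Algebra.Squarefree"
begin

text \<open>
  An element \<open>x\<close> of a semigroup lies in a subgroup as soon as it has a commuting inner
  inverse, that is, some \<open>y\<close> with \<open>x y x = x\<close> and \<open>x y = y x\<close>: then \<open>x y\<close> is an idempotent,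
  and \<open>x\<close> is a unit of the local monoid at this idempotent
  (\<open>commuting_inner_inverse_imp_in_subgroup\<close>). So it is enough to solve these two equations
  in \<open>T\<close>.

  As \<open>n\<close> is squarefree, they are solvable in the commutative monoid \<open>\<int>\<^sub>n\<close>, where they reduce to
  \<open>a b a = a\<close>: the integer \<open>a\<close> is invertible modulo \<open>n / gcd a n\<close>, because a common divisor of
  \<open>a\<close> and \<open>n / gcd a n\<close> also divides \<open>gcd a n\<close>, and its square would divide \<open>n\<close>. An inverse
  \<open>b\<close> of \<open>a\<close> modulo \<open>n / gcd a n\<close> satisfies \<open>a b a = a\<close> modulo \<open>n\<close>.

  A solution \<open>b\<close> for \<open>a\<close> lifts to \<open>T\<close>: the product in \<open>I \<times> \<int>\<^sub>n \<times> \<Lambda>\<close> of elements with the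
  same outer coordinates \<open>i\<close> and \<open>\<lambda>\<close> inserts the single entry \<open>p = P \<lambda> i\<close>, and since \<open>p\<close> is
  a unit, \<open>(i, p\<inverse> b p\<inverse>, \<lambda>)\<close> is a commuting inner inverse of \<open>(i, a, \<lambda>)\<close>.
\<close>

text \<open>
  The subgroup is the group of units of the local monoid \<open>e S e\<close>, where \<open>e = x y\<close>. The inverse of
  \<open>x\<close> there is \<open>y x y\<close> and not \<open>y\<close>, which need not lie in \<open>e S e\<close>.
\<close>

lemma commuting_inner_inverse_imp_in_subgroup:
  fixes S (structure)
  assumes S: "is_sgrp S" and x: "x \<in> carrier S" and y: "y \<in> carrier S"
    and xyx: "op S (op S x y) x = x" and xy: "op S x y = op S y x"
  shows "\<exists>H. subgroup_of_sgrp H S \<and> x \<in> H"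
proof -
  define m (infixl "\<cdot>" 70) where "m = op S"
  have cl: "a \<cdot> b \<in> carrier S" if "a \<in> carrier S" "b \<in> carrier S" for a b
    using S that unfolding is_sgrp_def m_def by blast
  have assoc: "a \<cdot> b \<cdot> c = a \<cdot> (b \<cdot> c)"
    if "a \<in> carrier S" "b \<in> carrier S" "c \<in> carrier S" for a b c
    using S that unfolding is_sgrp_def m_def by blast
  define e where "e = x \<cdot> y"
  define L where "L = {z \<in> carrier S. e \<cdot> z = z \<and> z \<cdot> e = z}"
  define H where "H = {z \<in> L. \<exists>w \<in> L. z \<cdot> w = e \<and> w \<cdot> z = e}"
  have e: "e \<in> carrier S" and ex: "e \<cdot> x = x" and e': "e = y \<cdot> x"
    using x y xyx xy cl by (simp_all add: e_def m_def)
  have xe: "x \<cdot> e = x"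
    using ex assoc[OF x y x] by (simp add: e_def e'[unfolded e_def])
  have ee: "e \<cdot> e = e"
    using assoc[OF e x y] ex by (simp add: e_def)
  have L_cl: "a \<cdot> b \<in> L" if "a \<in> L" "b \<in> L" for a b
  proof -
    have c: "a \<in> carrier S" "b \<in> carrier S" "e \<cdot> a = a" "b \<cdot> e = b"
      using that by (auto simp: L_def)
    then have "e \<cdot> (a \<cdot> b) = a \<cdot> b" "a \<cdot> b \<cdot> e = a \<cdot> b"
      using assoc[OF e c(1,2)] assoc[OF c(1,2) e] by simp_all
    then show ?thesis
      using c cl by (simp add: L_def)
  qed
  have e_L: "e \<in> L" and x_L: "x \<in> L"
    using e ee x ex xe by (auto simp: L_def)
  have H_cl: "a \<cdot> b \<in> H" if ab: "a \<in> H" "b \<in> H" for a b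
  proof -
    have inv_mult: "a \<cdot> b \<cdot> (d \<cdot> c) = e"
      if "a \<in> L" "b \<in> L" "c \<in> L" "d \<in> L" "a \<cdot> c = e" "b \<cdot> d = e" for a b c d
    proof -
      have c: "a \<in> carrier S" "b \<in> carrier S" "c \<in> carrier S" "d \<in> carrier S" "e \<cdot> c = c"
        using that by (auto simp: L_def)
      have "a \<cdot> b \<cdot> (d \<cdot> c) = a \<cdot> (b \<cdot> d \<cdot> c)"
        using c cl by (simp add: assoc)
      also have "\<dots> = e"
        using c that by simp
      finally show ?thesis .
    qed
    obtain c d where "a \<in> L" "c \<in> L" "a \<cdot> c = e" "c \<cdot> a = e"
      and "b \<in> L" "d \<in> L" "b \<cdot> d = e" "d \<cdot> b = e"
      using ab by (auto simp: H_def)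
    then show ?thesis
      unfolding H_def using L_cl inv_mult by blast
  qed
  have "group \<lparr>carrier = H, monoid.mult = op S, one = e\<rparr>"
  proof (rule groupI, simp_all flip: m_def)
    show "e \<in> H"
      using e_L ee by (auto simp: H_def)
    show "\<And>a b c. a \<in> H \<Longrightarrow> b \<in> H \<Longrightarrow> c \<in> H \<Longrightarrow> a \<cdot> b \<cdot> c = a \<cdot> (b \<cdot> c)"
      by (auto simp: H_def L_def assoc)
    show "\<And>a. a \<in> H \<Longrightarrow> e \<cdot> a = a"
      by (simp add: H_def L_def)
    show "\<And>a. a \<in> H \<Longrightarrow> \<exists>b\<in>H. b \<cdot> a = e"
      by (auto simp: H_def)
  qed (rule H_cl)
  moreover have "H \<subseteq> carrier S"
    by (auto simp: H_def L_def)
  moreover have "x \<in> H"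
  proof -
    let ?w = "y \<cdot> x \<cdot> y"
    have w: "?w = e \<cdot> y" "?w = y \<cdot> e"
      using assoc[OF y x y] by (simp_all add: e' flip: e_def)
    have "?w \<in> carrier S"
      using x y cl by simp
    moreover have "e \<cdot> ?w = ?w"
      using assoc[OF e e y] ee w by simp
    moreover have "?w \<cdot> e = ?w"
      using assoc[OF y e e] ee w by simp
    moreover have "x \<cdot> ?w = e"
      using assoc[OF x e y] xe w by (simp flip: e_def)
    moreover have "?w \<cdot> x = e"
      using assoc[OF y e x] ex w by (simp flip: e')
    ultimately show ?thesis
      using x_L by (auto simp: H_def L_def)
  qed
  ultimately show ?thesis
    unfolding subgroup_of_sgrp_def by blast
qed

lemma is_sgrp_Rees_matrix_sgrp:
  assumes "is_sgrp S" and "\<And>l i. l \<in> \<Lambda> \<Longrightarrow> i \<in> I \<Longrightarrow> P l i \<in> carrier S"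
  shows "is_sgrp (Rees_matrix_sgrp S I \<Lambda> P)"
  using assms unfolding is_sgrp_def Rees_matrix_sgrp_def by auto

lemma (in monoid) is_sgrp_mult_sgrp: "is_sgrp (mult_sgrp G)"
  by (simp add: is_sgrp_def mult_sgrp_def m_assoc)

text \<open>
  Commutativity is what lets the sandwich units cancel: \<open>a\<close> has to commute with
  \<open>p\<inverse>\<close> as well as with its inner inverse.
\<close>

theorem (in comm_monoid) completely_regular_Rees_matrix_sgrp:
  assumes regular: "\<And>a. a \<in> carrier G \<Longrightarrow> \<exists>b \<in> carrier G. a \<otimes> b \<otimes> a = a"
    and units: "\<And>l i. l \<in> \<Lambda> \<Longrightarrow> i \<in> I \<Longrightarrow> P l i \<in> Units G"
  shows "completely_regular (Rees_matrix_sgrp (mult_sgrp G) I \<Lambda> P)"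
    (is "completely_regular ?T")
proof -
  have T: "is_sgrp ?T"
    by (rule is_sgrp_Rees_matrix_sgrp[OF is_sgrp_mult_sgrp])
      (use units Units_closed in \<open>auto simp: mult_sgrp_def\<close>)
  moreover have "\<exists>H. subgroup_of_sgrp H ?T \<and> x \<in> H" if x_T: "x \<in> carrier ?T" for x
  proof -
    obtain i a l where x: "x = (i, a, l)" and i: "i \<in> I" and a: "a \<in> carrier G" and l: "l \<in> \<Lambda>"
      using x_T by (auto simp: Rees_matrix_sgrp_def mult_sgrp_def)
    obtain b where b: "b \<in> carrier G" and aba: "a \<otimes> b \<otimes> a = a"
      using regular a by blast
    define p q where "p = P l i" and "q = inv (P l i)"
    have p: "p \<in> carrier G" and q: "q \<in> carrier G" and pq: "p \<otimes> q = \<one>"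
      using units[OF l i] by (simp_all add: p_def q_def Units_closed)
    have cancel: "p \<otimes> (q \<otimes> z) = z" if "z \<in> carrier G" for z
      using p q pq that by (simp flip: m_assoc)
    define c where "c = q \<otimes> b \<otimes> q"
    have c: "c \<in> carrier G"
      using b q by (simp add: c_def)
    have apc: "a \<otimes> p \<otimes> c = a \<otimes> b \<otimes> q"
      using a b p q by (simp add: c_def m_assoc cancel)
    have "c \<otimes> p \<otimes> a = a \<otimes> p \<otimes> c"
      using a c p by (simp add: m_ac)
    moreover have "a \<otimes> p \<otimes> c \<otimes> p \<otimes> a = a"
    proof -
      have "a \<otimes> p \<otimes> c \<otimes> p \<otimes> a = p \<otimes> q \<otimes> (a \<otimes> b \<otimes> a)"
        unfolding apc using a b p q by (simp add: m_ac)
      then show ?thesis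
        using a aba pq by simp
    qed
    ultimately show ?thesis
      using i a l c
      by (intro commuting_inner_inverse_imp_in_subgroup[OF T x_T, of "(i, c, l)"])
        (simp_all add: x Rees_matrix_sgrp_def mult_sgrp_def flip: p_def)
  qed
  ultimately show ?thesis
    unfolding completely_regular_def by blast
qed

lemma squarefree_imp_regular_mod:
  fixes a n :: int
  assumes "squarefree n"
  shows "\<exists>b. (a * b * a) mod n = a mod n"
proof -
  obtain m where n: "n = gcd a n * m"
    by (metis dvdE gcd_dvd2)
  have "coprime a m"
  proof (rule coprimeI)
    fix d assume d: "d dvd a" "d dvd m"
    then have "d dvd gcd a n"
      by (metis n dvd_mult gcd_greatest)
    then have "d ^ 2 dvd n"
      using d n by (metis mult_dvd_mono power2_eq_square)
    then show "is_unit d"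
      using assms by (rule squarefreeD[rotated])
  qed
  then obtain b c where bc: "b * a + c * m = 1"
    by (metis bezout_int coprime_imp_gcd_eq_1)
  have "gcd a n * m dvd a * (c * m)"
    by (intro mult_dvd_mono) simp_all
  moreover have "a - a * b * a = a * (c * m)"
  proof -
    have "c * m = 1 - b * a"
      using bc by simp
    then show ?thesis
      by (simp only: right_diff_distrib mult_1_right mult.assoc)
  qed
  ultimately have "n dvd a - a * b * a"
    using n by simp
  then show ?thesis
    by (metis mod_eq_dvd_iff)
qed

lemma ZFact_regular:
  assumes "squarefree k" and "X \<in> carrier (ZFact k)"
  shows "\<exists>Y \<in> carrier (ZFact k). X \<otimes>\<^bsub>ZFact k\<^esub> Y \<otimes>\<^bsub>ZFact k\<^esub> X = X"
proof -
  interpret ideal "Idl\<^bsub>\<Z>\<^esub> {k}" \<Z>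
    by (rule int.genideal_ideal) fast
  have carr: "carrier (ZFact k) = range (ZMod k)"
    by (auto simp: ZFact_def ZMod_def FactRing_def A_RCOSETS_defs a_r_coset_defs r_coset_def)
  have mult: "ZMod k a \<otimes>\<^bsub>ZFact k\<^esub> ZMod k b = ZMod k (a * b)" for a b
    by (simp add: ZFact_def ZMod_def FactRing_def rcoset_mult_add)
  obtain a where X: "X = ZMod k a"
    using assms(2) carr by auto
  obtain b where "(a * b * a) mod k = a mod k"
    using squarefree_imp_regular_mod[OF assms(1)] by blast
  then have "ZMod k (a * b * a) = ZMod k a"
    by (rule zmod_imp_ZMod)
  then show ?thesis
    by (auto simp: X carr mult)
qed

theorem corollary1p4:
  fixes n :: nat and A :: "nat set"
    and I :: "'i set" and \<Lambda> :: "'l set" and P :: "'l \<Rightarrow> 'i \<Rightarrow> int set"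
  assumes "finite A" and "\<And>p. p \<in> A \<Longrightarrow> prime p" and "n = \<Prod>A"
    and "\<And>l i. l \<in> \<Lambda> \<Longrightarrow> i \<in> I \<Longrightarrow> P l i \<in> Units (ZFact (int n))"
  shows "completely_regular (Rees_matrix_sgrp (mult_sgrp (ZFact (int n))) I \<Lambda> P)"
proof -
  interpret cring "ZFact (int n)"
    by (rule ZFact_is_cring)
  have "squarefree (\<Prod>p\<in>A. int p)"
    using assms(2)
    by (intro squarefree_prod_coprime) (auto intro: primes_coprime squarefree_prime)
  then have "squarefree (int n)"
    using assms(3) by simp
  then show ?thesis
    using assms(4) by (intro completely_regular_Rees_matrix_sgrp ZFact_regular)
qed

end
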